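(* Let $p$ be an odd prime. In the polynomial ring $\mathbb{Z}_p[\beta]$, set $x=\beta(1-\beta)$ and $\alpha=1-\beta$. Then \[ \sum_{k=1}^{p-1}\binom{2k}{k}H_kx^k\equiv -2(\alpha-\beta)^{p-1}\pounds_1\left(\frac{\beta}{\beta-\alpha}\right)\pmod{p}, \] \[ \sum_{k=1}^{p-1}C_kH_kx^{k+1}\equiv\pounds_1(\beta)+(\alpha-\beta)^{p+1}\pounds_1\left(\frac{\beta}{\beta-\alpha}\right)\pmod{p}. \] (The right-hand sides are polynomials in $\beta$ after expanding $\pounds_1$ and cancelling the powers of $\alpha-\beta$.)
   Context: $\mathbb{Z}_p$ denotes the ring of $p$-adic integers. For the fixed prime $p$, $\pounds_1(t)=\sum_{k=1}^{p-1}t^k/k$ is the finite logarithm. $H_k=\sum_{j=1}^{k}1/j$ and $C_k=\frac{1}{k+1}\binom{2k}{k}$ is the Catalan number. Congruence modulo $p$ means the difference lies in $p\,\mathbb{Z}_p[\beta]$. *)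

theory Defs
  imports
    "HOL-Computational_Algebra.Computational_Algebra"
    "Berlekamp_Zassenhaus.Finite_Field"
begin

text \<open>
  The ring of \<open>p\<close>-adic integers, constructed as the inverse limit of the rings \<open>\<int>/p\<^sup>n\<close>:
  a \<open>p\<close>-adic integer is a compatible sequence of canonical residues modulo \<open>p\<^sup>n\<close>.
  The prime is carried by the type, \<open>p = CARD('p)\<close>; the class \<^class>\<open>prime_card\<close> says precisely
  that this cardinality is prime.
\<close>

typedef (overloaded) ('p::prime_card) padic_int =
  "{a :: nat \<Rightarrow> int. \<forall>n. a n \<in> {0..<int CARD('p) ^ n} \<and> a (Suc n) mod int CARD('p) ^ n = a n}"
proof
  show "(\<lambda>_. 0) \<in> {a :: nat \<Rightarrow> int. \<forall>n. a n \<in> {0..<int CARD('p) ^ n} \<and>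
          a (Suc n) mod int CARD('p) ^ n = a n}"
    by simp
qed

setup_lifting type_definition_padic_int

lemma mod_power_Suc_mod: "a mod (int q ^ Suc n) mod int q ^ n = a mod int q ^ n"
  by (simp add: mod_mod_cancel)

lemma padic_seqI:
  fixes f :: "nat \<Rightarrow> int"
  assumes "\<And>n. f (Suc n) mod int CARD('p::prime_card) ^ n = f n mod int CARD('p) ^ n"
  shows "f n mod int CARD('p) ^ n \<in> {0..<int CARD('p) ^ n} \<and>
         f (Suc n) mod int CARD('p) ^ Suc n mod int CARD('p) ^ n = f n mod int CARD('p) ^ n"
proof -
  have "CARD('p) > 0"
    using prime_card prime_gt_0_nat by blast
  then show ?thesis
    using assms[of n] by (simp only: mod_power_Suc_mod) simp
qed

instantiation padic_int :: (prime_card) comm_ring_1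
begin

lift_definition zero_padic_int :: "'a padic_int" is "\<lambda>n. 0"
  by simp

lift_definition one_padic_int :: "'a padic_int" is "\<lambda>n. 1 mod int CARD('a) ^ n"
  by (rule padic_seqI) simp

lift_definition plus_padic_int :: "'a padic_int \<Rightarrow> 'a padic_int \<Rightarrow> 'a padic_int"
  is "\<lambda>a b n. (a n + b n) mod int CARD('a) ^ n"
  by (rule padic_seqI) (metis mod_add_eq)

lift_definition uminus_padic_int :: "'a padic_int \<Rightarrow> 'a padic_int"
  is "\<lambda>a n. (- a n) mod int CARD('a) ^ n"
  by (rule padic_seqI) (metis mod_minus_eq)

lift_definition minus_padic_int :: "'a padic_int \<Rightarrow> 'a padic_int \<Rightarrow> 'a padic_int"
  is "\<lambda>a b n. (a n - b n) mod int CARD('a) ^ n"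
  by (rule padic_seqI) (metis mod_diff_eq)

lift_definition times_padic_int :: "'a padic_int \<Rightarrow> 'a padic_int \<Rightarrow> 'a padic_int"
  is "\<lambda>a b n. (a n * b n) mod int CARD('a) ^ n"
  by (rule padic_seqI) (metis mod_mult_eq)

instance
proof
  fix a b c :: "'a padic_int"
  show "a + b + c = a + (b + c)"
    by transfer (auto simp: mod_simps algebra_simps)
  show "a + b = b + a"
    by transfer (auto simp: algebra_simps)
  show "0 + a = a"
    by transfer auto
  show "- a + a = 0"
    by transfer (auto simp: mod_simps)
  show "a - b = a + - b"
    by transfer (auto simp: mod_simps)
  show "a * b * c = a * (b * c)"
    by transfer (auto simp: mod_simps algebra_simps)
  show "a * b = b * a"
    by transfer (auto simp: algebra_simps)
  show "1 * a = a"
    by transfer (auto simp: mod_simps)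
  show "(a + b) * c = a * c + b * c"
    by transfer (auto simp: mod_simps algebra_simps)
  show "(0 :: 'a padic_int) \<noteq> 1"
  proof transfer
    have "int CARD('a) > 1"
      using prime_card prime_gt_1_nat by (metis of_nat_1 of_nat_less_iff)
    then have "1 mod int CARD('a) ^ 1 \<noteq> 0"
      by simp
    then show "(\<lambda>n. 0) \<noteq> (\<lambda>n. 1 mod int CARD('a) ^ n)"
      by metis
  qed
qed

end

lemma padic_seq_mod:
  fixes a :: "nat \<Rightarrow> int"
  assumes "\<forall>n. a n \<in> {0..<int CARD('p::prime_card) ^ n} \<and> a (Suc n) mod int CARD('p) ^ n = a n"
  shows "a (n + k) mod int CARD('p) ^ n = a n"
proof (induction k)
  case 0
  then show ?case using assms by simp
next
  case (Suc k)
  have "a (n + Suc k) mod int CARD('p) ^ n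
          = a (Suc (n + k)) mod int CARD('p) ^ (n + k) mod int CARD('p) ^ n"
    by (simp add: mod_mod_cancel le_imp_power_dvd)
  then show ?case using Suc assms by simp
qed

lemma prime_power_add_dvd_mult:
  fixes q :: int
  assumes "prime q" "q ^ (m + n) dvd x * y"
  shows "q ^ m dvd x \<or> q ^ n dvd y"
proof (rule ccontr)
  assume contra: "\<not> ?thesis"
  then have nz: "x \<noteq> 0" "y \<noteq> 0"
    by auto
  have "multiplicity q x < m" "multiplicity q y < n"
    using contra nz assms(1) by (auto simp: power_dvd_iff_le_multiplicity not_le)
  moreover have "m + n \<le> multiplicity q (x * y)"
    using assms nz by (intro multiplicity_geI) (auto dest: not_prime_unit)
  moreover have "multiplicity q (x * y) = multiplicity q x + multiplicity q y"
    using assms(1) nz by (intro prime_elem_multiplicity_mult_distrib) auto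
  ultimately show False
    by simp
qed

instance padic_int :: (prime_card) idom
proof
  fix a b :: "'a padic_int"
  assume "a \<noteq> 0" "b \<noteq> 0"
  then show "a * b \<noteq> 0"
  proof transfer
    fix a b :: "nat \<Rightarrow> int"
    assume a: "\<forall>n. a n \<in> {0..<int CARD('a) ^ n} \<and> a (Suc n) mod int CARD('a) ^ n = a n"
      and b: "\<forall>n. b n \<in> {0..<int CARD('a) ^ n} \<and> b (Suc n) mod int CARD('a) ^ n = b n"
      and "a \<noteq> (\<lambda>n. 0)" "b \<noteq> (\<lambda>n. 0)"
    then obtain m n where mn: "a m \<noteq> 0" "b n \<noteq> 0"
      by blast
    have "a (m + n) mod int CARD('a) ^ m \<noteq> 0" "b (n + m) mod int CARD('a) ^ n \<noteq> 0"
      using padic_seq_mod[OF a] padic_seq_mod[OF b] mn by auto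
    moreover have "prime (int CARD('a))"
      using prime_card by simp
    ultimately have "\<not> int CARD('a) ^ (m + n) dvd a (m + n) * b (m + n)"
      using prime_power_add_dvd_mult by (metis add.commute dvd_imp_mod_0)
    then have "(a (m + n) * b (m + n)) mod int CARD('a) ^ (m + n) \<noteq> 0"
      by (simp add: dvd_eq_mod_eq_0)
    then show "(\<lambda>n. a n * b n mod int CARD('a) ^ n) \<noteq> (\<lambda>n. 0)"
      by metis
  qed
qed

text \<open>
  The fraction field of \<open>\<int>\<^sub>p[\<beta>]\<close>, in which the quotients \<open>1/k\<close> and \<open>\<beta>/(\<beta> - \<alpha>)\<close> are formed.
\<close>

type_synonym 'p padic_ratfun = "'p padic_int poly fract"

text \<open>
  Congruence modulo \<open>p\<close>: both sides are elements of the subring \<open>\<int>\<^sub>p[\<beta>]\<close> of the fraction field,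
  and their difference lies in \<open>p\<int>\<^sub>p[\<beta>]\<close>.
\<close>

definition poly_cong_p :: "('p::prime_card) padic_ratfun \<Rightarrow> 'p padic_ratfun \<Rightarrow> bool" where
  "poly_cong_p u v \<longleftrightarrow>
     (\<exists>f g. u = to_fract f \<and> v = to_fract g \<and> of_nat CARD('p) dvd f - g)"

definition finite_log :: "nat \<Rightarrow> 'a::field \<Rightarrow> 'a" where
  "finite_log p t = (\<Sum>k=1..p-1. t ^ k / of_nat k)"

definition harmonic :: "nat \<Rightarrow> 'a::field" where
  "harmonic k = (\<Sum>j=1..k. 1 / of_nat j)"

definition catalan :: "nat \<Rightarrow> 'a::field" where
  "catalan k = 1 / of_nat (k + 1) * of_nat ((2 * k) choose k)"

text \<open>
  The integers embed into \<open>\<int>\<^sub>p\<close>, so the denominators \<open>k\<close>, \<open>j\<close> and \<open>k + 1\<close> above are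
  nonzero in the fraction field and the divisions are genuine (\<open>\<beta> - \<alpha> = 2\<beta> - 1\<close> is nonzero as well).
\<close>

instance padic_int :: (prime_card) ring_char_0
proof
  have p: "CARD('a) > 1"
    using prime_card prime_gt_1_nat by blast
  have rep: "Rep_padic_int (of_nat m :: 'a padic_int) n = int m mod int CARD('a) ^ n" for m n
    by (induction m)
       (simp_all add: zero_padic_int.rep_eq one_padic_int.rep_eq plus_padic_int.rep_eq mod_simps)
  show "inj (of_nat :: nat \<Rightarrow> 'a padic_int)"
  proof
    fix m n :: nat
    assume eq: "(of_nat m :: 'a padic_int) = of_nat n"
    obtain k where k: "max m n < CARD('a) ^ k"
      using power_gt_expt[of "CARD('a)" "max m n"] p that by simp
    have "int m mod int CARD('a) ^ k = int n mod int CARD('a) ^ k"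
      using rep[of m k] rep[of n k] eq by simp
    with k show "m = n"
      by (simp flip: of_nat_power zmod_int)
  qed
qed

end

theory Submission
  imports Defs "HOL-Number_Theory.Cong"
begin

text \<open>
  Everything is transported to the fraction field \<open>K\<close> of \<open>\<bbbF>\<^sub>p[\<beta>]\<close>. Put \<open>p = 2m + 1\<close> and
  \<open>w = \<alpha> - \<beta> = 1 - 2\<beta>\<close>, so that \<open>w\<^sup>2 = 1 - 4x\<close>. In \<open>K\<close> the central binomial coefficient
  \<open>2k choose k\<close> equals \<open>(m choose k) (-4)\<^sup>k\<close>, hence the first sum is
  \<open>\<Sum>\<^sub>j (w\<^bsup>2m\<^esup> - w\<^bsup>2m-2j\<^esup>) / j\<close> over \<open>1 \<le> j \<le> m\<close>. This is identified with the finite logarithm by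
  \<open>2 \<pounds>\<^sub>1((1 - v)/2) = \<Sum>\<^sub>j (v\<^bsup>2j\<^esup> - 1) / j\<close> at \<open>v = 1/w\<close>: both sides are polynomials in \<open>v\<close> of
  degree less than \<open>p\<close>, with the same derivative and the same value at \<open>v = 1\<close>. In the same way
  \<open>2 \<pounds>\<^sub>1(\<beta>) = \<Sum>\<^sub>k (2k choose k) x\<^sup>k / k\<close>, and the recurrence
  \<open>(2k+2 choose k+1) + 2 C\<^sub>k = 4 (2k choose k)\<close> makes \<open>2 \<Sum>\<^sub>k C\<^sub>k H\<^sub>k x\<^bsup>k+1\<^esup> + w\<^sup>2 \<Sum>\<^sub>k (2k choose k) H\<^sub>k x\<^sup>k\<close>
  telescope to that sum, the boundary term vanishing because \<open>H\<^bsub>p-1\<^esub> = 0\<close> in \<open>K\<close>.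
\<close>

section \<open>Central binomial coefficients, Catalan and harmonic numbers\<close>

lemma central_binomial_Suc:
  "Suc n * (2 * Suc n choose Suc n) = 2 * (2 * n + 1) * (2 * n choose n)"
proof -
  have "Suc n * (2 * Suc n choose Suc n) = 2 * Suc n * (2 * n + 1 choose n)"
    using Suc_times_binomial_eq[of "2 * n + 1" n] by simp
  also have "Suc n * (2 * n + 1 choose n) = (2 * n + 1) * (2 * n choose n)"
    using Suc_times_binomial_eq[of "2 * n" n] binomial_symmetric[of n "2 * n + 1"] by simp
  then have "2 * Suc n * (2 * n + 1 choose n) = 2 * (2 * n + 1) * (2 * n choose n)"
    by (simp only: mult.assoc)
  finally show ?thesis .
qed

text \<open>An integral form that embeds in every ring: in characteristic \<open>p\<close> the
  quotient defining \<open>catalan (p - 1)\<close> has denominator \<open>p = 0\<close>.\<close>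

definition catalan_number :: "nat \<Rightarrow> nat" where
  "catalan_number k = (2 * k choose k) div (k + 1)"

text \<open>Absorption gives \<open>(k + 1) * (2 * k choose (k + 1)) = k * (2 * k choose k)\<close>,
  and \<open>k + 1\<close> is coprime to \<open>k\<close>, so the division is exact.\<close>

lemma catalan_number_mult: "(k + 1) * catalan_number k = (2 * k choose k)"
proof -
  have "(k + 1) * (2 * k choose (k + 1)) = 2 * k * (2 * k - 1 choose k)"
    using binomial_absorption[of k "2 * k"] by (simp only: Suc_eq_plus1)
  moreover have "(2 * k - k) * (2 * k choose k) = 2 * k * (2 * k - 1 choose k)"
    by (rule binomial_absorb_comp)
  ultimately have "(k + 1) * (2 * k choose (k + 1)) = k * (2 * k choose k)"
    by (metis add_diff_cancel_left' mult_2)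
  then have "k + 1 dvd k * (2 * k choose k)"
    by (metis dvd_triv_left)
  moreover have "coprime (k + 1) k"
    by simp
  ultimately have "k + 1 dvd (2 * k choose k)"
    using coprime_dvd_mult_right_iff by blast
  then show ?thesis
    unfolding catalan_number_def by (rule dvd_mult_div_cancel)
qed

text \<open>After multiplication by \<open>n + 1\<close> this is
  \<open>2 * (2 * n + 1) + 2 = 4 * (n + 1)\<close>.\<close>

lemma central_binomial_Suc_catalan:
  "(2 * Suc n choose Suc n) + 2 * catalan_number n = 4 * (2 * n choose n)"
proof -
  have "Suc n * ((2 * Suc n choose Suc n) + 2 * catalan_number n) = Suc n * (4 * (2 * n choose n))"
    unfolding distrib_left central_binomial_Suc
    using catalan_number_mult[of n] by (simp add: algebra_simps)
  then show ?thesis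
    by (metis mult_cancel1 nat.distinct(1))
qed

lemma of_nat_catalan_number:
  assumes "of_nat (k + 1) \<noteq> (0 :: 'a::field)"
  shows "of_nat (catalan_number k) = (catalan k :: 'a)"
proof -
  have "of_nat (k + 1) * of_nat (catalan_number k) = (of_nat (2 * k choose k) :: 'a)"
    by (metis catalan_number_mult of_nat_mult)
  then show ?thesis
    unfolding catalan_def using assms by (metis nonzero_mult_div_cancel_left times_divide_eq_left mult_1)
qed

lemma harmonic_Suc: "harmonic (Suc k) = harmonic k + 1 / of_nat (Suc k)"
  by (simp add: harmonic_def)

lemma harmonic_0 [simp]: "harmonic 0 = 0"
  by (simp add: harmonic_def)

text \<open>Clears the denominators of the finite logarithm. The bound on \<open>p\<close> makes
  \<open>n - k\<close> a genuine difference for all \<open>k \<le> p - 1\<close>.\<close>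

lemma finite_log_homogeneous:
  fixes a b :: "'a::field"
  assumes "b \<noteq> 0" "p \<le> n + 1"
  shows "b ^ n * finite_log p (a / b) = (\<Sum>k=1..p-1. a ^ k * b ^ (n - k) / of_nat k)"
  unfolding finite_log_def sum_distrib_left
  using assms by (intro sum.cong) (auto simp: power_diff power_divide)

lemma finite_log_0 [simp]: "finite_log p 0 = 0"
  unfolding finite_log_def by (intro sum.neutral) auto

section \<open>The identities over a field of odd characteristic\<close>

locale odd_char_field =
  fixes p m :: nat and K :: "'a::field itself"
  assumes char: "CHAR('a) = p" and p_eq: "p = 2 * m + 1"
begin

lemma odd_p: "odd p"
  using p_eq by simp

lemma prime_p: "prime p"
  using prime_CHAR_semidom[where ?'a='a] char odd_p by (cases "p = 0") auto

lemma of_nat_neq_0: "0 < k \<Longrightarrow> k < p \<Longrightarrow> of_nat k \<noteq> (0::'a)"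
  using char by (auto simp: of_nat_eq_0_iff_char_dvd dest: dvd_imp_le)

lemma p_ge_3: "3 \<le> p"
  using prime_p odd_p prime_ge_2_nat[of p] by (cases "p = 2") auto

lemma two_neq_0: "(2::'a) \<noteq> 0"
  using of_nat_neq_0[of 2] p_ge_3 by simp

lemma of_nat_p: "of_nat p = (0::'a)"
  using char of_nat_CHAR by blast

lemma two_m: "2 * of_nat m = (-1::'a)"
  using of_nat_p unfolding p_eq by (simp add: eq_neg_iff_add_eq_0 add.commute)

section \<open>Frobenius and binomial sums in characteristic \<open>p\<close>\<close>

lemma frobenius_add_poly: "(a + b) ^ p = a ^ p + b ^ p" for a b :: "'a poly"
  by (rule freshmans_dream) (simp_all add: char prime_p)

lemma frobenius_diff_poly: "(a - b) ^ p = a ^ p - b ^ p" for a b :: "'a poly"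
  using frobenius_add_poly[of a "- b"] power_minus_odd[OF odd_p, of b] by simp

text \<open>The classical expression of central binomials through the binomials of -1/2, whose role
  is played by \<open>m\<close> because \<open>2 * m = -1\<close>. Both sides obey the same
  first-order recurrence, and \<open>k + 1\<close> stays invertible below \<open>p\<close>.\<close>

lemma central_binomial_char:
  assumes "k < p"
  shows "of_nat (2 * k choose k) = (of_nat (m choose k) * (-4) ^ k :: 'a)"
  using assms
proof (induction k)
  case (Suc k)
  have *: "of_nat (Suc k) * of_nat (m choose Suc k) = ((of_nat m - of_nat k) * of_nat (m choose k) :: 'a)"
  \<comment> \<open>Truncated subtraction agrees with field subtraction only here; for larger
    \<open>k\<close> both binomials vanish.\<close>
  proof (cases "k \<le> m")
    case True
    have "Suc k * (m choose Suc k) = (m - k) * (m choose k)"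
      using binomial_absorb_comp[of m k] binomial_absorption[of k m] by simp
    then show ?thesis using True
      by (metis of_nat_diff of_nat_mult)
  qed (simp add: binomial_eq_0)
  have "of_nat (Suc k) * (of_nat (2 * Suc k choose Suc k) :: 'a) = of_nat (2 * (2 * k + 1) * (2 * k choose k))"
    using central_binomial_Suc by (metis of_nat_mult)
  \<comment> \<open>The factor \<open>2 * k + 1\<close> becomes \<open>2 * k - 2 * m\<close> since
    \<open>2 * m = -1\<close>.\<close>
  also have "\<dots> = 2 * (2 * of_nat k - 2 * of_nat m) * (of_nat (m choose k) * (-4) ^ k)"
    using Suc unfolding two_m by (simp add: algebra_simps)
  also have "\<dots> = ((of_nat m - of_nat k) * of_nat (m choose k)) * (-4) ^ Suc k"
    by (simp add: algebra_simps)
  also have "\<dots> = of_nat (Suc k) * (of_nat (m choose Suc k) * (-4) ^ Suc k)"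
    unfolding *[symmetric] by simp
  finally show ?case
    using of_nat_neq_0[of "Suc k"] Suc.prems by (metis mult_left_cancel zero_less_Suc)
qed simp

text \<open>Pascal's rule and \<open>harmonic_Suc\<close> show that passing from \<open>n\<close> to
  \<open>n + 1\<close> multiplies the sum by \<open>1 + y\<close> and adds
  \<open>((1 + y) ^ (n + 1) - 1) / (n + 1)\<close>. The right-hand side obeys the same
  recurrence.\<close>

lemma sum_binomial_harmonic:
  fixes y :: 'a
  assumes "n < p"
  shows "(\<Sum>k\<le>n. of_nat (n choose k) * harmonic k * y ^ k)
       = (\<Sum>j=1..n. ((1 + y) ^ n - (1 + y) ^ (n - j)) / of_nat j)"
  using assms
proof (induction n)
  case (Suc n)
  define S where "S = (\<Sum>k\<le>n. of_nat (n choose k) * harmonic k * y ^ k)"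
  have nz: "of_nat (Suc n) \<noteq> (0::'a)"
    using of_nat_neq_0[of "Suc n"] Suc.prems by blast
  have sh: "(\<Sum>k\<le>Suc n. f k) = f 0 + (\<Sum>k\<le>n. f (Suc k))" for f :: "nat \<Rightarrow> 'a"
    by (rule sum.atMost_Suc_shift)
  have "(\<Sum>k\<le>Suc n. of_nat (Suc n choose k) * harmonic k * y ^ k)
      = (\<Sum>k\<le>n. of_nat (n choose Suc k) * harmonic (Suc k) * y ^ Suc k)
      + (\<Sum>k\<le>n. of_nat (n choose k) * harmonic (Suc k) * y ^ Suc k)"
    unfolding sh by (simp add: algebra_simps sum.distrib)
  also have "(\<Sum>k\<le>n. of_nat (n choose Suc k) * harmonic (Suc k) * y ^ Suc k)
      = (\<Sum>k\<le>Suc n. of_nat (n choose k) * harmonic k * y ^ k)"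
    unfolding sh by simp
  also have "\<dots> = S"
    by (simp add: S_def binomial_eq_0)
  also have "(\<Sum>k\<le>n. of_nat (n choose k) * harmonic (Suc k) * y ^ Suc k)
      = y * S + (\<Sum>k\<le>n. of_nat (n choose k) / of_nat (Suc k) * y ^ Suc k)"
    unfolding S_def sum_distrib_left sum.distrib[symmetric] harmonic_Suc
    by (intro sum.cong) (auto simp: algebra_simps)
  also have "(\<Sum>k\<le>n. of_nat (n choose k) / of_nat (Suc k) * y ^ Suc k)
      = (\<Sum>k\<le>n. of_nat (Suc n choose Suc k) * y ^ Suc k) / of_nat (Suc n)"
    unfolding sum_divide_distrib
  proof (intro sum.cong refl)
    fix k assume k: "k \<in> {..n}"
    then have nzk: "of_nat (Suc k) \<noteq> (0::'a)"
      using of_nat_neq_0[of "Suc k"] Suc.prems by auto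
    have "of_nat (Suc n) * of_nat (n choose k) = (of_nat (Suc k) * of_nat (Suc n choose Suc k) :: 'a)"
      using Suc_times_binomial_eq[of n k] by (metis of_nat_mult mult.commute)
    then show "of_nat (n choose k) / of_nat (Suc k) * y ^ Suc k = of_nat (Suc n choose Suc k) * y ^ Suc k / of_nat (Suc n)"
      using nz nzk by (simp add: frac_eq_eq del: of_nat_Suc binomial_Suc_Suc) (metis mult.commute mult.left_commute)
  qed
  also have "(\<Sum>k\<le>n. of_nat (Suc n choose Suc k) * y ^ Suc k) = (1 + y) ^ Suc n - 1"
    using binomial_ring[of y 1 "Suc n"] unfolding sh by (simp add: add.commute)
  also have "S = (\<Sum>j=1..n. ((1 + y) ^ n - (1 + y) ^ (n - j)) / of_nat j)"
    using Suc unfolding S_def by simp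
  \<comment> \<open>The factor \<open>1 + y\<close> raises each exponent by one; the extra fraction
    is the new summand \<open>j = n + 1\<close>.\<close>
  also have "\<dots> + (y * \<dots> + ((1 + y) ^ Suc n - 1) / of_nat (Suc n)) = 
     (\<Sum>j=1..n. (1 + y) * (((1 + y) ^ n - (1 + y) ^ (n - j)) / of_nat j)) + ((1 + y) ^ Suc n - 1) / of_nat (Suc n)"
    unfolding sum_distrib_left[symmetric] by (simp only: distrib_right mult_1 add.assoc)
  also have "(\<Sum>j=1..n. (1 + y) * (((1 + y) ^ n - (1 + y) ^ (n - j)) / of_nat j))
     = (\<Sum>j=1..n. ((1 + y) ^ Suc n - (1 + y) ^ (Suc n - j)) / of_nat j)"
    by (intro sum.cong) (auto simp: right_diff_distrib Suc_diff_le)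
  finally show ?case
    by simp
qed (simp)

text \<open>In characteristic \<open>p\<close> a vanishing derivative leaves only exponents
  divisible by \<open>p\<close>; the degree bound leaves a constant, which the root makes
  zero.\<close>

lemma poly_eq_0_if_pderiv_eq_0:
  fixes f :: "'a poly"
  assumes "pderiv f = 0" "Polynomial.degree f < p" "poly f a = 0"
  shows "f = 0"
proof -
  have *: "of_nat (Suc n) * Polynomial.coeff f (Suc n) = 0" for n
    using assms(1) by (metis coeff_pderiv Polynomial.coeff_0)
  have "Polynomial.degree f = 0"
  proof (rule ccontr)
    assume "Polynomial.degree f \<noteq> 0"
    then obtain n where n: "Polynomial.degree f = Suc n"
      by (metis not0_implies_Suc)
    then have "Polynomial.coeff f (Suc n) \<noteq> 0"
      by (metis leading_coeff_0_iff degree_0 nat.distinct(1))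
    then show False
      using *[of n] of_nat_neq_0[of "Suc n"] n assms(2) by (metis mult_eq_0_iff zero_less_Suc)
  qed
  then obtain c where "f = [:c:]"
    by (rule degree_eq_zeroE)
  with assms(3) show ?thesis
    by simp
qed

section \<open>Polynomial identities for the finite logarithm, by comparing derivatives\<close>

lemma pderiv_sum: "pderiv (sum f A) = (\<Sum>i\<in>A. pderiv (f i))" for f :: "'b \<Rightarrow> 'a poly"
  using higher_pderiv_sum[of 1 f A] by simp

abbreviation X :: "'a poly" where "X \<equiv> [:0, 1:]"

definition log_poly :: "'a poly" where
  "log_poly = (\<Sum>k=1..p-1. Polynomial.smult (1 / of_nat k) (X ^ k))"

lemma poly_log_poly: "poly log_poly t = finite_log p t"
  by (simp add: log_poly_def finite_log_def poly_sum)

lemma degree_log_poly: "Polynomial.degree log_poly \<le> p - 1"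
  unfolding log_poly_def
  by (intro degree_sum_le) (auto intro!: order.trans[OF degree_smult_le] order.trans[OF degree_power_le])

text \<open>The derivative is a geometric sum. The factor \<open>X * (1 - X)\<close> clears its
  denominator and leaves an additive polynomial, to which Frobenius applies after
  substitution.\<close>

lemma pderiv_log_poly: "X * (1 - X) * pderiv log_poly = X - X ^ p"
proof -
  have "pderiv log_poly = (\<Sum>k=1..p-1. X ^ (k - 1))"
    unfolding log_poly_def pderiv_sum
  proof (intro sum.cong refl)
    fix k assume "k \<in> {1..p-1}"
    then have "of_nat k \<noteq> (0::'a)"
      by (intro of_nat_neq_0) auto
    then show "pderiv (Polynomial.smult (1 / of_nat k) (X ^ k)) = X ^ (k - 1)"
      by (simp add: pderiv_smult pderiv_power pderiv_pCons)
  qed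
  also have "\<dots> = (\<Sum>k<p-1. X ^ k)"
    by (rule sum.reindex_bij_witness[of _ Suc "\<lambda>k. k - 1"]) auto
  finally have "X * (1 - X) * pderiv log_poly = X * (1 - X ^ (p - 1))"
    by (simp only: one_diff_power_eq mult.assoc)
  also have "\<dots> = X - X * X ^ (p - 1)"
    by (simp only: right_diff_distrib mult_1_right)
  also have "X * X ^ (p - 1) = X ^ p"
    using p_ge_3 by (metis power_eq_if not_numeral_le_zero)
  finally show ?thesis .
qed

lemma two_power_p_poly: "2 ^ p = (2::'a poly)"
  using frobenius_add_poly[of 1 1] by simp

text \<open>A geometric series in the square of \<open>X\<close>, with \<open>1 + 2 * m = p\<close>;
  the sum is half the derivative of the right-hand side of \<open>finite_log_half\<close>.\<close>

lemma sum_odd_powers: "(1 - X\<^sup>2) * (\<Sum>j=1..m. X ^ (2 * j - 1)) = X - X ^ p"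
proof -
  have "(\<Sum>j=1..m. X ^ (2 * j - 1)) = (\<Sum>j<m. X * (X\<^sup>2) ^ j)"
    by (rule sum.reindex_bij_witness[of _ Suc "\<lambda>k. k - 1"])
       (auto simp flip: power_mult power_Suc simp: Suc_diff_Suc intro!: arg_cong2[of _ _ _ _ "(^)"])
  also have "\<dots> = X * (\<Sum>j<m. (X\<^sup>2) ^ j)"
    by (simp only: sum_distrib_left)
  finally have "(1 - X\<^sup>2) * (\<Sum>j=1..m. X ^ (2 * j - 1)) = X * (1 - (X\<^sup>2) ^ m)"
    by (simp only: one_diff_power_eq mult.left_commute)
  also have "\<dots> = X - X ^ p"
    by (simp add: p_eq algebra_simps flip: power_mult)
  finally show ?thesis .
qed

lemma finite_log_half:
  fixes v :: 'a
  shows "2 * finite_log p ((1 - v) / 2) = (\<Sum>j=1..m. (v ^ (2 * j) - 1) / of_nat j)"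
proof -
  \<comment> \<open>The argument \<open>(1 - v) / 2\<close> as a polynomial in \<open>v\<close>;
    \<open>F\<close> is the difference of the two sides, to be shown zero.\<close>
  define q :: "'a poly" where "q = [:1/2, -1/2:]"
  define F where "F = Polynomial.smult 2 (pcompose log_poly q)
    - (\<Sum>j=1..m. Polynomial.smult (1 / of_nat j) (X ^ (2 * j) - 1))"
  define Q where "Q = pcompose (pderiv log_poly) q"
  have two_q: "2 * q = 1 - X"
    using two_neq_0 by (simp add: q_def numeral_poly one_pCons)
  have two_poly: "(2::'a poly) \<noteq> 0"
    using two_neq_0 by (simp add: numeral_poly)
  have "q * (1 - q) * Q = q - q ^ p"
    using arg_cong[OF pderiv_log_poly, of "\<lambda>f. pcompose f q"]
    by (simp only: pcompose_mult pcompose_diff pcompose_1 pcompose_hom.hom_power Q_def) simp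
  moreover have "(2 * q) * (2 - 2 * q) * Q = 4 * (q * (1 - q) * Q)"
    by (simp add: algebra_simps)
  ultimately have "(2 * q) * (2 - 2 * q) * Q = 2 * ((2 * q) - 2 * q ^ p)"
    by simp
  also have "2 * q ^ p = (2 * q) ^ p"
    unfolding power_mult_distrib two_power_p_poly ..
  \<comment> \<open>Frobenius gives \<open>(1 - X) ^ p = 1 - X ^ p\<close>, so the constants
    cancel.\<close>
  finally have "(1 - X) * (2 - (1 - X)) * Q = 2 * (X ^ p - X)"
    unfolding two_q frobenius_diff_poly by simp
  moreover have "(1 - X) * (2 - (1 - X)) = 1 - X\<^sup>2"
    by (simp add: algebra_simps power2_eq_square)
  ultimately have Q: "(1 - X\<^sup>2) * Q = 2 * (X ^ p - X)"
    by (simp only:)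
  have "pderiv F = - Q - 2 * (\<Sum>j=1..m. X ^ (2 * j - 1))"
  proof -
    have "pderiv (Polynomial.smult (1 / of_nat j) (X ^ (2 * j) - 1)) = 2 * X ^ (2 * j - 1)"
      if "j \<in> {1..m}" for j
    proof -
      have "of_nat j \<noteq> (0::'a)"
        using that p_eq by (intro of_nat_neq_0) auto
      then show ?thesis
        by (simp add: pderiv_smult pderiv_power pderiv_diff pderiv_pCons numeral_poly)
    qed
    then have "pderiv (\<Sum>j=1..m. Polynomial.smult (1 / of_nat j) (X ^ (2 * j) - 1))
        = 2 * (\<Sum>j=1..m. X ^ (2 * j - 1))"
      unfolding pderiv_sum sum_distrib_left by (intro sum.cong) auto
    \<comment> \<open>The chain rule contributes -1/2, which the factor 2 turns into -1.\<close>
    moreover have "pderiv (Polynomial.smult 2 (pcompose log_poly q)) = - Q"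
      using two_neq_0 by (simp add: pderiv_smult pderiv_pcompose Q_def q_def pderiv_pCons)
    ultimately show ?thesis
      unfolding F_def pderiv_diff by simp
  qed
  moreover have "a * (- f - 2 * g) = - (a * f) - 2 * (a * g)" for a f g :: "'a poly"
    by (simp add: algebra_simps)
  ultimately have "(1 - X\<^sup>2) * pderiv F = - (2 * (X ^ p - X)) - 2 * (X - X ^ p)"
    by (simp only: Q sum_odd_powers)
  also have "\<dots> = 0"
    by (simp only: right_diff_distrib) simp
  finally have "(1 - X\<^sup>2) * pderiv F = 0" .
  moreover have "1 - X\<^sup>2 \<noteq> 0"
    by (simp add: power2_eq_square one_pCons)
  ultimately have "pderiv F = 0"
    by (metis mult_eq_0_iff)
  moreover have "Polynomial.degree F < p"
  proof -
    have "Polynomial.degree (pcompose log_poly q) \<le> p - 1"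
      using degree_pcompose_le[of log_poly q] degree_log_poly two_neq_0 by (simp add: q_def)
    then have "Polynomial.degree F \<le> p - 1"
      unfolding F_def using p_eq
      by (intro degree_diff_le degree_sum_le)
        (auto intro!: order.trans[OF degree_smult_le] degree_diff_le order.trans[OF degree_power_le])
    then show ?thesis
      using p_ge_3 by simp
  qed
  moreover have "poly F 1 = 0"
    using two_neq_0 by (simp add: F_def poly_pcompose poly_log_poly q_def poly_sum)
  ultimately have "F = 0"
    by (rule poly_eq_0_if_pderiv_eq_0)
  then have "poly F v = 0"
    by simp
  moreover have "poly q v = (1 - v) / 2"
    using two_neq_0 by (simp add: q_def field_simps)
  ultimately show ?thesis
    by (simp add: F_def poly_pcompose poly_log_poly poly_sum)
qed

text \<open>The case \<open>v = -1\<close> of \<open>finite_log_half\<close>: the argument is 1,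
  where the finite logarithm is this harmonic number, and even powers of -1 are 1.\<close>

lemma harmonic_p_minus_1: "harmonic (p - 1) = (0::'a)"
proof -
  have "2 * finite_log p ((1 - (- 1)) / 2 :: 'a) = 0"
    unfolding finite_log_half by simp
  moreover have "(1 - (- 1)) / 2 = (1::'a)"
    using two_neq_0 by simp
  ultimately show ?thesis
    using two_neq_0 by (simp add: finite_log_def harmonic_def)
qed

lemma sum_eq_sum_atMost_m:
  fixes f :: "nat \<Rightarrow> 'a"
  shows "(\<Sum>k=1..p-1. of_nat (2 * k choose k) * f k * x ^ k)
       = (\<Sum>k=1..m. of_nat (m choose k) * f k * (- 4 * x) ^ k)"
proof -
  have "(\<Sum>k=1..p-1. of_nat (2 * k choose k) * f k * x ^ k)
      = (\<Sum>k=1..p-1. of_nat (m choose k) * f k * (- 4 * x) ^ k)"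
    by (intro sum.cong refl, subst central_binomial_char) (auto simp flip: power_mult_distrib)
  also have "\<dots> = (\<Sum>k=1..m. of_nat (m choose k) * f k * (- 4 * x) ^ k)"
    using p_eq by (intro sum.mono_neutral_right) (auto simp: binomial_eq_0)
  finally show ?thesis .
qed

text \<open>Both sides are polynomials in \<open>b\<close> of degree below \<open>p\<close> that
  vanish at 0, and multiplying their derivatives by \<open>X * (1 - X)\<close> gives
  \<open>2 * (X - X ^ p)\<close> each time.\<close>

lemma finite_log_central_binomial:
  fixes b :: 'a
  defines "x \<equiv> b * (1 - b)"
  shows "2 * finite_log p b = (\<Sum>k=1..p-1. of_nat (2 * k choose k) * (1 / of_nat k) * x ^ k)"
proof -
  define Y where "Y = X * (1 - X)"
  define u where "u = 1 - 2 * X"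
  define G where "G = Polynomial.smult 2 log_poly
    - (\<Sum>k=1..m. Polynomial.smult (of_nat (m choose k) * (1 / of_nat k)) ((- 4 * Y) ^ k))"
  have dY: "pderiv Y = u"
    by (simp add: Y_def u_def pderiv_mult pderiv_diff pderiv_pCons numeral_poly one_pCons)
  have uY: "1 + - 4 * Y = u\<^sup>2"
    unfolding u_def Y_def by (simp add: algebra_simps power2_eq_square)
  have "Y * pderiv (Polynomial.smult (of_nat (m choose k) * (1 / of_nat k)) ((- 4 * Y) ^ k))
      = u * (of_nat (m choose k) * (- 4 * Y) ^ k)" if "k \<in> {1..m}" for k
  proof -
    have nz: "of_nat k \<noteq> (0::'a)"
      using that p_eq by (intro of_nat_neq_0) auto
    have "pderiv (- 4 * Y) = - 4 * u"
      by (simp add: pderiv_smult pderiv_minus dY numeral_poly)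
    then have "pderiv (Polynomial.smult (of_nat (m choose k) * (1 / of_nat k)) ((- 4 * Y) ^ k))
      = Polynomial.smult (of_nat (m choose k)) ((- 4 * Y) ^ (k - 1) * (- 4 * u))"
      using nz by (simp add: pderiv_smult pderiv_power)
    also have "\<dots> = of_nat (m choose k) * ((- 4 * Y) ^ (k - 1) * (- 4 * u))"
      by (simp add: of_nat_poly)
    finally have "Y * pderiv (Polynomial.smult (of_nat (m choose k) * (1 / of_nat k)) ((- 4 * Y) ^ k))
      = u * (of_nat (m choose k) * ((- 4 * Y) * (- 4 * Y) ^ (k - 1)))"
      by (simp only: mult_ac)
    also have "(- 4 * Y) * (- 4 * Y) ^ (k - 1) = (- 4 * Y) ^ k"
      using that by (metis atLeastAtMost_iff not_one_le_zero power_eq_if)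
    finally show ?thesis .
  qed
  then have "Y * pderiv (\<Sum>k=1..m. Polynomial.smult (of_nat (m choose k) * (1 / of_nat k)) ((- 4 * Y) ^ k))
      = u * (\<Sum>k=1..m. of_nat (m choose k) * (- 4 * Y) ^ k)"
    unfolding pderiv_sum sum_distrib_left by (intro sum.cong) auto
  also have "(\<Sum>k=1..m. of_nat (m choose k) * (- 4 * Y) ^ k) = (1 + - 4 * Y) ^ m - 1"
    using binomial_ring[of "- 4 * Y" 1 m]
    by (simp add: add.commute atMost_atLeast0 sum.atLeast_Suc_atMost[of 0])
  \<comment> \<open>As \<open>1 - 4 * Y\<close> is the square of \<open>u\<close> and
    \<open>1 + 2 * m = p\<close>, the product is a \<open>p\<close>-th power, which Frobenius
    expands.\<close>
  also have "u * ((1 + - 4 * Y) ^ m - 1) = u ^ p - u"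
    unfolding uY p_eq by (simp add: algebra_simps flip: power_mult)
  also have "u ^ p = 1 - 2 * X ^ p"
    unfolding u_def frobenius_diff_poly power_mult_distrib two_power_p_poly by simp
  finally have "Y * pderiv (\<Sum>k=1..m. Polynomial.smult (of_nat (m choose k) * (1 / of_nat k)) ((- 4 * Y) ^ k))
      = 2 * (X - X ^ p)"
    unfolding u_def by (simp only: right_diff_distrib) simp
  moreover have "Y * pderiv (Polynomial.smult 2 log_poly) = 2 * (X - X ^ p)"
    unfolding Y_def pderiv_log_poly[symmetric] by (simp add: pderiv_smult numeral_poly)
  ultimately have "Y * pderiv G = 0"
    unfolding G_def pderiv_diff right_diff_distrib by simp
  moreover have "Y \<noteq> 0"
    by (simp add: Y_def one_pCons)
  ultimately have "pderiv G = 0"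
    by (metis mult_eq_0_iff)
  moreover have "Polynomial.degree G < p"
  proof -
    \<comment> \<open>Powers of \<open>Y\<close> up to \<open>m\<close> thus have degree at most
      \<open>2 * m = p - 1\<close>, which is why the sum was first cut off at
      \<open>m\<close>.\<close>
    have degY: "Polynomial.degree (- 4 * Y) \<le> 2"
      by (simp add: Y_def numeral_poly one_pCons)
    have "Polynomial.degree G \<le> p - 1"
      unfolding G_def
    proof (intro degree_diff_le degree_sum_le)
      fix k assume "k \<in> {1..m}"
      then show "Polynomial.degree (Polynomial.smult (of_nat (m choose k) * (1 / of_nat k)) ((- 4 * Y) ^ k)) \<le> p - 1"
        using order.trans[OF degree_power_le[of "- 4 * Y" k] mult_right_mono[OF degY, of k]] p_eq
        by (intro order.trans[OF degree_smult_le]) simp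
    next
      show "Polynomial.degree (Polynomial.smult 2 log_poly) \<le> p - 1"
        using degree_smult_le degree_log_poly by (rule order.trans)
    qed simp
    then show ?thesis
      using p_ge_3 by simp
  qed
  moreover have "poly G 0 = 0"
    by (simp add: G_def poly_log_poly poly_sum Y_def power_0_left)
  ultimately have "G = 0"
    by (rule poly_eq_0_if_pderiv_eq_0)
  then have "poly G b = 0"
    by simp
  then show ?thesis
    unfolding sum_eq_sum_atMost_m x_def
    by (simp add: G_def poly_log_poly poly_sum Y_def algebra_simps)
qed

section \<open>The two harmonic sums in characteristic \<open>p\<close>\<close>

lemma sum_central_binomial_harmonic:
  fixes b :: 'a
  defines "x \<equiv> b * (1 - b)"
  assumes u: "1 - 2 * b \<noteq> 0"
  shows "(\<Sum>k=1..p-1. of_nat (2 * k choose k) * harmonic k * x ^ k)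
       = - 2 * (1 - 2 * b) ^ (p - 1) * finite_log p (b / (2 * b - 1))"
proof -
  define w where "w = 1 - 2 * b"
  have w: "w \<noteq> 0" "1 + - 4 * x = w\<^sup>2"
    using u by (simp_all add: w_def x_def algebra_simps power2_eq_square)
  have "(\<Sum>k=1..p-1. of_nat (2 * k choose k) * harmonic k * x ^ k)
      = (\<Sum>k\<le>m. of_nat (m choose k) * harmonic k * (- 4 * x) ^ k)"
    unfolding sum_eq_sum_atMost_m by (simp add: atMost_atLeast0 sum.atLeast_Suc_atMost[of 0])
  also have "\<dots> = (\<Sum>j=1..m. ((w\<^sup>2) ^ m - (w\<^sup>2) ^ (m - j)) / of_nat j)"
    using p_eq unfolding w(2)[symmetric] by (intro sum_binomial_harmonic) simp
  \<comment> \<open>Pulling out \<open>w ^ (2 * m)\<close> produces the shape of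
    \<open>finite_log_half\<close> at \<open>v = 1 / w\<close>, up to sign.\<close>
  also have "\<dots> = - ((w\<^sup>2) ^ m) * (\<Sum>j=1..m. ((1 / w) ^ (2 * j) - 1) / of_nat j)"
    unfolding sum_distrib_left
    using w(1) by (intro sum.cong) 
      (auto simp: power_diff power_mult_distrib power2_eq_square mult_2 mult_2_right power_add field_simps)
  also have "\<dots> = - 2 * w ^ (p - 1) * finite_log p ((1 - 1 / w) / 2)"
    unfolding finite_log_half[symmetric] by (simp add: p_eq power_mult)
  also have "(1 - 1 / w) / 2 = b / (2 * b - 1)"
  proof -
    have "b = (1 - w) / 2" "2 * b - 1 = - w"
      using two_neq_0 by (simp_all add: w_def)
    moreover have "(1 - 1 / w) / 2 = (1 - w) / 2 / (- w)"
      using w(1) two_neq_0 by (simp add: field_simps)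
    ultimately show ?thesis
      by (simp only:)
  qed
  finally show ?thesis
    by (simp add: w_def)
qed

text \<open>The Catalan term and the \<open>- 4 * x\<close> part at index \<open>k\<close> combine
  to minus the central binomial at \<open>k + 1\<close> times \<open>harmonic k\<close>. Against the
  next term only \<open>harmonic (k + 1) - harmonic k = 1 / (k + 1)\<close> survives; the boundary
  term is what remains at \<open>n\<close>.\<close>

lemma telescoping_catalan_harmonic:
  fixes x :: 'a
  assumes "n < p"
  shows "2 * (\<Sum>k=1..n. of_nat (catalan_number k) * harmonic k * x ^ (k + 1))
      + (1 - 4 * x) * (\<Sum>k=1..n. of_nat (2 * k choose k) * harmonic k * x ^ k)
      = (\<Sum>k=1..n. of_nat (2 * k choose k) * (1 / of_nat k) * x ^ k)
        + (2 * of_nat (catalan_number n) - 4 * of_nat (2 * n choose n)) * harmonic n * x ^ (n + 1)"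
  using assms
proof (induction n)
  case (Suc n)
  have c: "2 * of_nat (catalan_number n) - 4 * of_nat (2 * n choose n)
      = - (of_nat (2 * Suc n choose Suc n) :: 'a)"
    using arg_cong[OF central_binomial_Suc_catalan[of n], of "of_nat :: nat \<Rightarrow> 'a"]
    by (simp add: algebra_simps add_eq_0_iff)
  have IH: "2 * (\<Sum>k=1..n. of_nat (catalan_number k) * harmonic k * x ^ (k + 1))
      + (1 - 4 * x) * (\<Sum>k=1..n. of_nat (2 * k choose k) * harmonic k * x ^ k)
      = (\<Sum>k=1..n. of_nat (2 * k choose k) * (1 / of_nat k) * x ^ k)
        - of_nat (2 * Suc n choose Suc n) * harmonic n * x ^ (n + 1)"
    using Suc unfolding c by (simp del: binomial_Suc_Suc)
  \<comment> \<open>Pure ring algebra: \<open>c\<close>, \<open>d\<close>, \<open>H\<close> are the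
    Catalan, central binomial and harmonic numbers at \<open>n + 1\<close>, \<open>h\<close> is
    \<open>harmonic n\<close>, \<open>i\<close> is \<open>1 / (n + 1)\<close> and \<open>y\<close>
    is \<open>x ^ (n + 1)\<close>.\<close>
  have step: "2 * (S + c * H * (x * y)) + (1 - 4 * x) * (T + d * H * y)
      = U + d * i * y + (2 * c - 4 * d) * H * (x * y)"
    if "2 * S + (1 - 4 * x) * T = U - d * h * y" "H = h + i" for S T U c d h i H y :: 'a
  proof -
    have "2 * (S + c * H * (x * y)) + (1 - 4 * x) * (T + d * H * y)
        = (2 * S + (1 - 4 * x) * T) + 2 * c * H * (x * y) + (1 - 4 * x) * d * H * y"
      by (simp add: algebra_simps)
    also have "\<dots> = U + d * i * y + (2 * c - 4 * d) * H * (x * y)"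
      unfolding that by (simp add: algebra_simps)
    finally show ?thesis .
  qed
  have split: "(\<Sum>k=1..Suc n. f k) = (\<Sum>k=1..n. f k) + f (Suc n)" for f :: "nat \<Rightarrow> 'a"
    by simp
  have pow: "x ^ (Suc n + 1) = x * x ^ Suc n" "x ^ (n + 1) = x ^ Suc n"
    by simp_all
  show ?case
    using IH unfolding split pow by (rule step[OF _ harmonic_Suc])
qed simp

text \<open>Telescoping up to \<open>p - 1\<close> has no boundary term because
  \<open>harmonic (p - 1) = 0\<close>. The factor \<open>1 - 4 * x\<close>, the square of
  \<open>1 - 2 * b\<close>, raises the exponent from \<open>p - 1\<close> to
  \<open>p + 1\<close>.\<close>

lemma sum_catalan_harmonic:
  fixes b :: 'a
  defines "x \<equiv> b * (1 - b)"
  assumes u: "1 - 2 * b \<noteq> 0"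
  shows "(\<Sum>k=1..p-1. of_nat (catalan_number k) * harmonic k * x ^ (k + 1))
       = finite_log p b + (1 - 2 * b) ^ (p + 1) * finite_log p (b / (2 * b - 1))"
proof -
  let ?C = "\<Sum>k=1..p-1. of_nat (catalan_number k) * harmonic k * x ^ (k + 1)"
  have "2 * ?C + (1 - 4 * x) * (- 2 * (1 - 2 * b) ^ (p - 1) * finite_log p (b / (2 * b - 1)))
      = 2 * finite_log p b"
    using telescoping_catalan_harmonic[of "p - 1" x] p_ge_3 harmonic_p_minus_1
      sum_central_binomial_harmonic[OF u] finite_log_central_binomial[of b]
    by (simp add: x_def)
  also have "(1 - 4 * x) * (- 2 * (1 - 2 * b) ^ (p - 1) * finite_log p (b / (2 * b - 1)))
      = - 2 * ((1 - 2 * b) ^ (p - 1) * (1 - 2 * b)\<^sup>2 * finite_log p (b / (2 * b - 1)))"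
    unfolding x_def by (simp add: algebra_simps power2_eq_square)
  also have "(1 - 2 * b) ^ (p - 1) * (1 - 2 * b)\<^sup>2 = (1 - 2 * b) ^ (p + 1)"
    using p_ge_3 by (simp flip: power_add)
  finally have "2 * ?C = 2 * (finite_log p b + (1 - 2 * b) ^ (p + 1) * finite_log p (b / (2 * b - 1)))"
    by (simp add: algebra_simps)
  then show ?thesis
    by (simp only: mult_left_cancel[OF two_neq_0])
qed

end

section \<open>Reduction of \<open>p\<close>-adic integers modulo \<open>p\<close>\<close>

lemma Rep_padic_int_range: "Rep_padic_int (a :: 'p::prime_card padic_int) n \<in> {0..<int CARD('p) ^ n}"
  using Rep_padic_int[of a] by blast

lemma Rep_padic_int_mod:
  "Rep_padic_int (a :: 'p::prime_card padic_int) (n + k) mod int CARD('p) ^ n = Rep_padic_int a n"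
  using Rep_padic_int[of a] by (intro padic_seq_mod) blast

lemma Rep_padic_int_of_nat:
  "Rep_padic_int (of_nat m :: 'p::prime_card padic_int) n = int m mod int CARD('p) ^ n"
  by (induction m)
     (simp_all add: zero_padic_int.rep_eq one_padic_int.rep_eq plus_padic_int.rep_eq mod_simps)

text \<open>Inverses of \<open>j\<close> exist modulo every power of \<open>p\<close>; cancelling
  \<open>j\<close> shows that they are compatible, so they define an element of the inverse
  limit.\<close>

lemma padic_int_inverse_exists:
  assumes "0 < j" "j < CARD('p::prime_card)"
  shows "\<exists>c :: 'p padic_int. of_nat j * c = 1"
proof -
  define P where "P = int CARD('p)"
  have "coprime j CARD('p)"
    using prime_imp_coprime[of "CARD('p)" j] prime_card[where ?'a='p] nat_dvd_not_less[OF assms]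
    by (simp add: coprime_commute)
  then have cop: "coprime (int j) (P ^ n)" for n
    by (simp add: P_def)
  then have "\<forall>n. \<exists>x. [int j * x = 1] (mod P ^ n)"
    using cong_solve_coprime_int by blast
  then obtain f where f: "\<And>n. [int j * f n = 1] (mod P ^ n)"
    by metis
  define b where "b n = f n mod P ^ n" for n
  have "f (Suc n) mod P ^ n = f n mod P ^ n" for n
  proof -
    have "[int j * f (Suc n) = 1] (mod P ^ n)"
      using cong_dvd_modulus[OF f[of "Suc n"], of "P ^ n"] by simp
    then have "[int j * f (Suc n) = int j * f n] (mod P ^ n)"
      using f cong_sym cong_trans by blast
    then have "[f (Suc n) = f n] (mod P ^ n)"
      using cong_mult_lcancel[OF cop] by blast
    then show ?thesis
      by (simp add: cong_def)
  qed
  then have "b \<in> {a. \<forall>n. a n \<in> {0..<int CARD('p) ^ n} \<and> a (Suc n) mod int CARD('p) ^ n = a n}"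
    unfolding b_def P_def mem_Collect_eq by (intro allI padic_seqI)
  then have "Rep_padic_int (Abs_padic_int b :: 'p padic_int) = b"
    by (rule Abs_padic_int_inverse)
  then have "Rep_padic_int (of_nat j * Abs_padic_int b :: 'p padic_int) n = Rep_padic_int (1 :: 'p padic_int) n" for n
    using f[of n] by (simp add: times_padic_int.rep_eq one_padic_int.rep_eq Rep_padic_int_of_nat
        b_def P_def cong_def mod_simps)
  then show ?thesis
    by (metis Rep_padic_int_inject ext)
qed

text \<open>Component 1 is the residue modulo \<open>p\<close>; component 0 is a residue modulo
  1.\<close>

definition padic_mod :: "'p::prime_card padic_int \<Rightarrow> 'p mod_ring" where
  "padic_mod a = of_int (Rep_padic_int a 1)"

lemma of_int_mod_card: "of_int (x mod int CARD('p)) = (of_int x :: 'p::prime_card mod_ring)"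
  by (metis of_int_mod_CHAR semiring_char_mod_ring)

interpretation padic_mod: comm_ring_hom padic_mod
  by unfold_locales
     (simp_all add: padic_mod_def zero_padic_int.rep_eq one_padic_int.rep_eq plus_padic_int.rep_eq
        times_padic_int.rep_eq uminus_padic_int.rep_eq of_int_mod_card)

interpretation padic_mod_poly: map_poly_comm_ring_hom padic_mod ..

lemma padic_mod_eq_0_imp_dvd:
  fixes a :: "'p::prime_card padic_int"
  assumes "padic_mod a = 0"
  shows "of_nat CARD('p) dvd a"
proof -
  define P where "P = int CARD('p)"
  have P: "P > 0"
    by (simp add: P_def)
  have "P dvd Rep_padic_int a 1"
    using assms unfolding padic_mod_def P_def
    by (metis of_int_eq_0_iff_char_dvd semiring_char_mod_ring)
  then have a1: "Rep_padic_int a 1 = 0"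
    using Rep_padic_int_range[of a 1] by (auto simp: P_def dest: zdvd_imp_le)
  have a_mod: "Rep_padic_int a (Suc n) mod P = 0" for n
    using Rep_padic_int_mod[of a 1 n] a1 by (simp add: P_def)
  \<comment> \<open>The quotient of \<open>a\<close> by \<open>p\<close>. The index shifts because
    dividing a residue modulo \<open>P ^ (n + 1)\<close> by \<open>P\<close> gives a residue modulo
    \<open>P ^ n\<close>.\<close>
  define b where "b n = Rep_padic_int a (Suc n) div P" for n
  have Pb: "P * b n = Rep_padic_int a (Suc n)" for n
    using a_mod[of n] by (auto simp: b_def)
  have "b n \<in> {0..<P ^ n} \<and> b (Suc n) mod P ^ n = b n" for n
  proof
    have "P * b n \<in> {0..<P * P ^ n}"
      using Rep_padic_int_range[of a "Suc n"] unfolding Pb by (simp add: P_def)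
    then show "b n \<in> {0..<P ^ n}"
      using P by (simp add: zero_le_mult_iff)
    have "P * (b (Suc n) mod P ^ n) = (P * b (Suc n)) mod (P * P ^ n)"
      by simp
    also have "\<dots> = P * b n"
      unfolding Pb using Rep_padic_int_mod[of a "Suc n" 1] by (simp add: P_def)
    finally show "b (Suc n) mod P ^ n = b n"
      using P by simp
  qed
  then have "b \<in> {a. \<forall>n. a n \<in> {0..<int CARD('p) ^ n} \<and> a (Suc n) mod int CARD('p) ^ n = a n}"
    by (simp add: P_def)
  then have "Rep_padic_int (Abs_padic_int b :: 'p padic_int) = b"
    by (rule Abs_padic_int_inverse)
  then have "Rep_padic_int (of_nat CARD('p) * Abs_padic_int b :: 'p padic_int) n = P * b n mod P ^ n" for n
    by (simp add: times_padic_int.rep_eq Rep_padic_int_of_nat P_def mod_simps)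
  also have "P * b n mod P ^ n = Rep_padic_int a n" for n
    unfolding Pb using Rep_padic_int_mod[of a n 1] by (simp add: P_def)
  finally have "of_nat CARD('p) * Abs_padic_int b = a"
    by (metis Rep_padic_int_inject ext)
  then show ?thesis
    by (metis dvd_triv_left)
qed

text \<open>Membership in \<open>\<int>\<^sub>p[\<beta>]\<close> together with the residue in \<open>\<bbbF>\<^sub>p[\<beta>]\<close>.\<close>

definition reduces_to :: "'p::prime_card padic_ratfun \<Rightarrow> 'p mod_ring poly fract \<Rightarrow> bool" where
  "reduces_to u v \<longleftrightarrow> (\<exists>f. u = to_fract f \<and> v = to_fract (map_poly padic_mod f))"

lemma to_fract_of_nat [simp]: "to_fract (of_nat n) = of_nat n"
  by (induction n) auto

lemma reduces_to_of_nat: "reduces_to (of_nat n) (of_nat n)"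
  unfolding reduces_to_def by (intro exI[of _ "of_nat n"]) (simp add: padic_mod_poly.hom_of_nat)

lemma reduces_to_1: "reduces_to 1 1"
  using reduces_to_of_nat[of 1] by simp

lemma reduces_to_add: "reduces_to u v \<Longrightarrow> reduces_to u' v' \<Longrightarrow> reduces_to (u + u') (v + v')"
  unfolding reduces_to_def by (metis padic_mod_poly.hom_add to_fract_add)

lemma reduces_to_diff: "reduces_to u v \<Longrightarrow> reduces_to u' v' \<Longrightarrow> reduces_to (u - u') (v - v')"
  unfolding reduces_to_def by (metis padic_mod_poly.hom_minus to_fract_diff)

lemma reduces_to_mult: "reduces_to u v \<Longrightarrow> reduces_to u' v' \<Longrightarrow> reduces_to (u * u') (v * v')"
  unfolding reduces_to_def by (metis padic_mod_poly.hom_mult to_fract_mult)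

lemma reduces_to_uminus: "reduces_to u v \<Longrightarrow> reduces_to (- u) (- v)"
  unfolding reduces_to_def by (metis padic_mod_poly.hom_uminus to_fract_uminus)

lemma reduces_to_power: "reduces_to u v \<Longrightarrow> reduces_to (u ^ n) (v ^ n)"
  by (induction n) (auto intro: reduces_to_1 reduces_to_mult)

lemma reduces_to_sum: "(\<And>i. i \<in> A \<Longrightarrow> reduces_to (f i) (g i)) \<Longrightarrow> reduces_to (sum f A) (sum g A)"
proof (induction A rule: infinite_finite_induct)
  case (insert i A)
  then show ?case
    by (simp add: reduces_to_add)
qed (use reduces_to_of_nat[of 0] in auto)

lemma reduces_to_X: "reduces_to (to_fract [:0, 1:]) (to_fract [:0, 1:])"
  unfolding reduces_to_def by (intro exI[of _ "[:0, 1:]"]) simp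

text \<open>The inverse lies in the \<open>p\<close>-adic integers, and its residue inverts
  \<open>j\<close> because reduction is a ring homomorphism.\<close>

lemma reduces_to_inverse_of_nat:
  assumes "0 < j" "j < CARD('p::prime_card)"
  shows "reduces_to (1 / of_nat j) (1 / of_nat j :: 'p mod_ring poly fract)"
proof -
  obtain c :: "'p padic_int" where c: "of_nat j * c = 1"
    using padic_int_inverse_exists[OF assms] by blast
  have 1: "of_nat j * [:c:] = 1"
    using c by (simp add: of_nat_poly one_pCons mult.commute)
  then have 2: "of_nat j * map_poly padic_mod [:c:] = 1"
    by (metis padic_mod_poly.hom_mult padic_mod_poly.hom_of_nat padic_mod_poly.hom_one)
  have inv: "y = 1 / x" if "x * y = 1" for x y :: "'a::field"
    using that by (metis mult_eq_0_iff nonzero_eq_divide_eq mult.commute zero_neq_one)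
  show ?thesis
    unfolding reduces_to_def
    using 1 2 by (intro exI[of _ "[:c:]"] conjI inv[symmetric])
      (metis to_fract_mult to_fract_of_nat to_fract_1)+
qed

lemma reduces_to_harmonic:
  assumes "k < CARD('p::prime_card)"
  shows "reduces_to (harmonic k) (harmonic k :: 'p mod_ring poly fract)"
  unfolding harmonic_def
  using assms by (intro reduces_to_sum reduces_to_inverse_of_nat) auto

text \<open>Equal residues force every coefficient of the difference into the kernel of
  \<open>padic_mod\<close>, which consists of multiples of \<open>p\<close>.\<close>

lemma poly_cong_p_if_reduces_to:
  fixes u v :: "'p::prime_card padic_ratfun"
  assumes "reduces_to u w" "reduces_to v w"
  shows "poly_cong_p u v"
proof -
  obtain f g where f: "u = to_fract f" "w = to_fract (map_poly padic_mod f)"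
    and g: "v = to_fract g" "w = to_fract (map_poly padic_mod g)"
    using assms unfolding reduces_to_def by auto
  have eq: "map_poly padic_mod f = map_poly padic_mod g"
    using f g by simp
  have "[:of_nat CARD('p):] dvd f - g"
    unfolding const_poly_dvd_iff
  proof
    fix n
    have "padic_mod (Polynomial.coeff (f - g) n) = 0"
      using arg_cong[OF eq, of "\<lambda>h. Polynomial.coeff h n"] by (simp add: padic_mod.hom_minus)
    then show "of_nat CARD('p) dvd Polynomial.coeff (f - g) n"
      by (rule padic_mod_eq_0_imp_dvd)
  qed
  then show ?thesis
    unfolding poly_cong_p_def using f g by (auto simp: of_nat_poly)
qed

lemma CHAR_mod_ring_poly_fract: "CHAR('p::prime_card mod_ring poly fract) = CARD('p)"
proof (rule CHAR_eqI)
  show "of_nat CARD('p) = (0 :: 'p mod_ring poly fract)"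
    using to_fract_of_nat[of "CARD('p)", where ?'a = "'p mod_ring poly"]
    by (simp add: of_nat_poly)
next
  fix n
  assume "of_nat n = (0 :: 'p mod_ring poly fract)"
  then have "of_nat n = (0 :: 'p mod_ring poly)"
    by (simp flip: to_fract_of_nat)
  then show "CARD('p) dvd n"
    by (simp add: of_nat_eq_0_iff_char_dvd)
qed

lemma reduces_to_finite_log:
  assumes "reduces_to a b"
  shows "reduces_to (finite_log CARD('p::prime_card) a) (finite_log CARD('p) (b :: 'p mod_ring poly fract))"
proof -
  have "reduces_to (a ^ k / of_nat k) (b ^ k / of_nat k)" if "k \<in> {1..CARD('p) - 1}" for k
  proof -
    have "0 < k" "k < CARD('p)"
      using that by auto
    then show ?thesis
      using reduces_to_mult[OF reduces_to_power[OF assms] reduces_to_inverse_of_nat] by simp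
  qed
  then show ?thesis
    unfolding finite_log_def by (rule reduces_to_sum)
qed

text \<open>The quotient \<open>a / b\<close> need not be a polynomial, so reduction goes through
  the denominator-free form, term by term.\<close>

lemma reduces_to_finite_log_homogeneous:
  assumes "reduces_to a c" "reduces_to b d" "b \<noteq> 0" "d \<noteq> 0" "CARD('p::prime_card) \<le> n + 1"
  shows "reduces_to (b ^ n * finite_log CARD('p) (a / b))
           (d ^ n * finite_log CARD('p) (c / d :: 'p mod_ring poly fract))"
proof -
  have "reduces_to (a ^ k * b ^ (n - k) / of_nat k) (c ^ k * d ^ (n - k) / of_nat k)"
    if "k \<in> {1..CARD('p) - 1}" for k
  proof -
    have "0 < k" "k < CARD('p)"
      using that by auto
    then show ?thesis
      using reduces_to_mult[OF reduces_to_mult[OF reduces_to_power[OF assms(1)] reduces_to_power[OF assms(2)]]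
          reduces_to_inverse_of_nat, of k k "n - k"] by simp
  qed
  then show ?thesis
    unfolding finite_log_homogeneous[OF assms(3,5)] finite_log_homogeneous[OF assms(4,5)]
    by (rule reduces_to_sum)
qed

section \<open>Transfer of both identities to congruences over the \<open>p\<close>-adic
  integers\<close>

theorem theorem7p2:
  fixes p :: nat and \<alpha> \<beta> x :: "('p::prime_card) padic_ratfun"
  defines "p \<equiv> CARD('p)"
    and "\<beta> \<equiv> to_fract [:0, 1:]"
    and "x \<equiv> \<beta> * (1 - \<beta>)"
    and "\<alpha> \<equiv> 1 - \<beta>"
  assumes "odd p"
  shows "poly_cong_p
           (\<Sum>k=1..p-1. of_nat ((2 * k) choose k) * harmonic k * x ^ k)
           (- 2 * (\<alpha> - \<beta>) ^ (p - 1) * finite_log p (\<beta> / (\<beta> - \<alpha>)))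
       \<and> poly_cong_p
           (\<Sum>k=1..p-1. catalan k * harmonic k * x ^ (k + 1))
           (finite_log p \<beta> + (\<alpha> - \<beta>) ^ (p + 1) * finite_log p (\<beta> / (\<beta> - \<alpha>)))"
proof -
  define m where "m = (p - 1) div 2"
  have p_eq: "p = 2 * m + 1"
    using \<open>odd p\<close> by (auto simp: m_def elim: oddE)
  interpret K: odd_char_field p m "TYPE('p mod_ring poly fract)"
    using p_eq by unfold_locales (simp_all add: CHAR_mod_ring_poly_fract p_def)
  define b :: "'p mod_ring poly fract" where "b = to_fract [:0, 1:]"
  define y where "y = b * (1 - b)"
  have red_b: "reduces_to \<beta> b"
    unfolding \<beta>_def b_def by (rule reduces_to_X)
  have red_x: "reduces_to x y"
    unfolding x_def y_def by (intro reduces_to_mult reduces_to_diff reduces_to_1 red_b)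
  have red_u: "reduces_to (\<beta> - \<alpha>) (2 * b - 1)"
    using reduces_to_diff[OF reduces_to_mult[OF reduces_to_of_nat[of 2] red_b] reduces_to_1]
    by (simp add: \<alpha>_def algebra_simps)
  have "\<beta> - \<alpha> = to_fract [:-1, 2:]"
    by (simp add: \<alpha>_def \<beta>_def one_pCons flip: to_fract_1 to_fract_diff)
  then have u_neq_0: "\<beta> - \<alpha> \<noteq> 0"
    by simp
  have "2 * b - 1 = to_fract [:-1, 2:]"
    by (simp add: b_def mult_2 one_pCons flip: to_fract_1 to_fract_diff to_fract_add)
  then have v_neq_0: "2 * b - 1 \<noteq> 0"
    by simp
  then have v_neq_0': "1 - 2 * b \<noteq> 0"
    by simp
  \<comment> \<open>Serves \<open>n = p - 1\<close> and \<open>n = p + 1\<close>; evenness absorbs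
    the sign between \<open>\<alpha> - \<beta>\<close> and the denominator
    \<open>\<beta> - \<alpha>\<close>.\<close>
  have red_log: "reduces_to ((\<alpha> - \<beta>) ^ n * finite_log p (\<beta> / (\<beta> - \<alpha>)))
                   ((1 - 2 * b) ^ n * finite_log p (b / (2 * b - 1)))"
    if "even n" "p \<le> n + 1" for n
  proof -
    have "(\<alpha> - \<beta>) ^ n = (\<beta> - \<alpha>) ^ n" "(1 - 2 * b) ^ n = (2 * b - 1) ^ n"
      using power_minus_even[OF that(1), of "\<beta> - \<alpha>"] power_minus_even[OF that(1), of "2 * b - 1"]
      by simp_all
    then show ?thesis
      using reduces_to_finite_log_homogeneous[OF red_b red_u u_neq_0 v_neq_0] that(2)
      by (simp add: p_def)
  qed
  have red_h: "reduces_to (harmonic k) (harmonic k :: 'p mod_ring poly fract)" if "k \<in> {1..p-1}" for k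
    using that by (intro reduces_to_harmonic) (auto simp: p_def)
  have "reduces_to (\<Sum>k=1..p-1. of_nat ((2 * k) choose k) * harmonic k * x ^ k)
          (\<Sum>k=1..p-1. of_nat ((2 * k) choose k) * harmonic k * y ^ k)"
    by (intro reduces_to_sum reduces_to_mult reduces_to_of_nat reduces_to_power red_x red_h)
  moreover have "reduces_to (- 2 * (\<alpha> - \<beta>) ^ (p - 1) * finite_log p (\<beta> / (\<beta> - \<alpha>)))
      (- 2 * (1 - 2 * b) ^ (p - 1) * finite_log p (b / (2 * b - 1)))"
    using reduces_to_mult[OF reduces_to_uminus[OF reduces_to_of_nat[of 2]] red_log[of "p - 1"]] \<open>odd p\<close>
    by (simp add: mult.assoc)
  ultimately have 1: "poly_cong_p
           (\<Sum>k=1..p-1. of_nat ((2 * k) choose k) * harmonic k * x ^ k)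
           (- 2 * (\<alpha> - \<beta>) ^ (p - 1) * finite_log p (\<beta> / (\<beta> - \<alpha>)))"
    unfolding y_def K.sum_central_binomial_harmonic[OF v_neq_0'] by (rule poly_cong_p_if_reduces_to)
  \<comment> \<open>Reducing the integer rather than the quotient covers \<open>k = p - 1\<close>,
    where the denominator \<open>k + 1 = p\<close> is not a \<open>p\<close>-adic unit.\<close>
  have cat: "of_nat (catalan_number k) = (catalan k :: 'p padic_ratfun)" for k
  proof (rule of_nat_catalan_number)
    have "of_nat (k + 1) \<noteq> (0 :: 'p padic_int poly)"
      by (simp only: of_nat_eq_0_iff)
    then show "of_nat (k + 1) \<noteq> (0 :: 'p padic_ratfun)"
      by (metis to_fract_of_nat to_fract_eq_0_iff)
  qed
  have "reduces_to (\<Sum>k=1..p-1. catalan k * harmonic k * x ^ (k + 1))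
          (\<Sum>k=1..p-1. of_nat (catalan_number k) * harmonic k * y ^ (k + 1))"
    unfolding cat[symmetric]
    by (intro reduces_to_sum reduces_to_mult reduces_to_of_nat reduces_to_power red_x red_h)
  moreover have "reduces_to (finite_log p \<beta> + (\<alpha> - \<beta>) ^ (p + 1) * finite_log p (\<beta> / (\<beta> - \<alpha>)))
      (finite_log p b + (1 - 2 * b) ^ (p + 1) * finite_log p (b / (2 * b - 1)))"
    using \<open>odd p\<close>
    by (intro reduces_to_add red_log) (simp_all add: p_def reduces_to_finite_log red_b)
  ultimately have 2: "poly_cong_p
           (\<Sum>k=1..p-1. catalan k * harmonic k * x ^ (k + 1))
           (finite_log p \<beta> + (\<alpha> - \<beta>) ^ (p + 1) * finite_log p (\<beta> / (\<beta> - \<alpha>)))"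
    unfolding y_def K.sum_catalan_harmonic[OF v_neq_0'] by (rule poly_cong_p_if_reduces_to)
  from 1 2 show ?thesis ..
qed

end
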